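(* (1) Let $f(a,x,y)$ be a three-variable analytic function in a neighborhood of $(0,0,0)\in\mathbb{C}^3$. If $f$ satisfies the $q$-difference equation $$x\big[f(a,x,y)-f(a,x,qy)\big]=y\big[f(a,qx,qy)-f(a,x,qy)\big]-ay\big[f(a,qx,q^2y)-f(a,x,q^2y)\big],$$ then $$f(a,x,y)=\widetilde{E}(a,y;D_q)\big\{f(a,x,0)\big\},$$ where $D_q$ acts on the variable $x$. (2) Let $f(a,x,y,z)$ be a four-variable analytic function in a neighborhood of $(0,0,0,0)\in\mathbb{C}^4$. If $f$ satisfies the $q$-difference equation $$(q^{-1}x-y)\big[f(a,x,y,z)-f(a,x,y,qz)\big]=z\big[f(a,q^{-1}x,y,qz)-f(a,x,qy,qz)\big]+az\big[f(a,x,qy,q^2z)-f(a,q^{-1}x,y,q^2z)\big],$$ then $$f(a,x,y,z)=\widetilde{L}(a,z;\theta_{xy})\big\{f(a,x,y,0)\big\}.$$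
   Context: $q$ is a fixed complex number with $0<|q|<1$. The $q$-shifted factorial is $(a;q)_0=1$, $(a;q)_n=\prod_{i=0}^{n-1}(1-aq^i)$ for $n\ge1$. The $q$-difference operators are $$D_q\{f(x)\}=\frac{f(x)-f(qx)}{x},\qquad \theta_{xy}\{f(x,y)\}=\frac{f(q^{-1}x,y)-f(x,qy)}{q^{-1}x-y},$$ with powers denoting iteration and the zeroth power the identity. The homogeneous $q$-difference operators are $$\widetilde{E}(a,b;D_q)=\sum_{k=0}^\infty \frac{(-1)^kq^{k(k-1)/2}(a;q)_k}{(q;q)_k}(b\,D_q)^k,\qquad \widetilde{L}(a,b;\theta_{xy})=\sum_{k=0}^\infty\frac{q^{k(k-1)/2}(a;q)_k}{(q;q)_k}(b\,\theta_{xy})^k,$$ where $(bD_q)^k$ means $b^kD_q^k$ and $(b\,\theta_{xy})^k$ means $b^k\theta_{xy}^k$ (the parameter $b$ is treated as a constant for the operators). The functional equations and conclusions are understood near the origin, wherever all arguments lie in the domain of $f$. *)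

theory Defs
  imports "HOL-Analysis.Analysis"
begin

text \<open>
  Analyticity in several complex variables: the function is given near every point of the set by an
  absolutely convergent multiple power series (for complex families, summability in the sense of
  \<open>has_sum\<close> is absolute summability). The predicates are meant for open sets.
\<close>

definition analytic2_on :: "(complex \<times> complex \<Rightarrow> complex) \<Rightarrow> (complex \<times> complex) set \<Rightarrow> bool" where
  "analytic2_on f U \<longleftrightarrow>
    (\<forall>(x0, y0) \<in> U. \<exists>r>0. \<exists>c. \<forall>x y. norm (x - x0) < r \<longrightarrow> norm (y - y0) < r \<longrightarrow>
      ((\<lambda>(i, j). c i j * (x - x0) ^ i * (y - y0) ^ j) has_sum f (x, y)) (UNIV :: (nat \<times> nat) set))"

definition analytic3_on ::
  "(complex \<times> complex \<times> complex \<Rightarrow> complex) \<Rightarrow> (complex \<times> complex \<times> complex) set \<Rightarrow> bool" where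
  "analytic3_on f U \<longleftrightarrow>
    (\<forall>(a0, x0, y0) \<in> U. \<exists>r>0. \<exists>c. \<forall>a x y.
      norm (a - a0) < r \<longrightarrow> norm (x - x0) < r \<longrightarrow> norm (y - y0) < r \<longrightarrow>
      ((\<lambda>(h, i, j). c h i j * (a - a0) ^ h * (x - x0) ^ i * (y - y0) ^ j) has_sum f (a, x, y))
        (UNIV :: (nat \<times> nat \<times> nat) set))"

definition analytic4_on ::
  "(complex \<times> complex \<times> complex \<times> complex \<Rightarrow> complex)
    \<Rightarrow> (complex \<times> complex \<times> complex \<times> complex) set \<Rightarrow> bool" where
  "analytic4_on f U \<longleftrightarrow>
    (\<forall>(a0, x0, y0, z0) \<in> U. \<exists>r>0. \<exists>c. \<forall>a x y z.
      norm (a - a0) < r \<longrightarrow> norm (x - x0) < r \<longrightarrow> norm (y - y0) < r \<longrightarrow> norm (z - z0) < r \<longrightarrow>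
      ((\<lambda>(h, i, j, l). c h i j l * (a - a0) ^ h * (x - x0) ^ i * (y - y0) ^ j * (z - z0) ^ l)
        has_sum f (a, x, y, z)) (UNIV :: (nat \<times> nat \<times> nat \<times> nat) set))"

definition qpoch :: "complex \<Rightarrow> complex \<Rightarrow> nat \<Rightarrow> complex" where
  "qpoch a q n = (\<Prod>i<n. 1 - a * q ^ i)"

text \<open>
  At the origin, where the defining quotient is \<open>0/0\<close>, the \<open>q\<close>-derivative takes its limiting value
  (the singularity is removable whenever \<open>g\<close> is analytic at the origin).
\<close>

definition Dq :: "complex \<Rightarrow> (complex \<Rightarrow> complex) \<Rightarrow> complex \<Rightarrow> complex" where
  "Dq q g x = (if x = 0 then Lim (at 0) (\<lambda>t. (g t - g (q * t)) / t) else (g x - g (q * x)) / x)"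

definition theta :: "complex \<Rightarrow> (complex \<times> complex \<Rightarrow> complex) \<Rightarrow> complex \<times> complex \<Rightarrow> complex" where
  "theta q g = (\<lambda>(x, y). (g (x / q, y) - g (x, q * y)) / (x / q - y))"

text \<open>\<open>has_Etilde q a b g x s\<close>: the series for \<open>E(a, b; D\<^sub>q){g}\<close> at \<open>x\<close> converges with sum \<open>s\<close>.\<close>

definition has_Etilde ::
  "complex \<Rightarrow> complex \<Rightarrow> complex \<Rightarrow> (complex \<Rightarrow> complex) \<Rightarrow> complex \<Rightarrow> complex \<Rightarrow> bool" where
  "has_Etilde q a b g x s \<longleftrightarrow>
    (\<lambda>k. (-1) ^ k * q ^ (k * (k - 1) div 2) * qpoch a q k / qpoch q q k * (b ^ k * (Dq q ^^ k) g x)) sums s"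

text \<open>
  Since \<open>q\<^sup>-\<^sup>1\<close> is expanding, the quotient formula for the \<open>k\<close>-th power of \<open>theta\<close> applied to a
  function \<open>g\<close> with domain \<open>W\<close> can be evaluated only on a region shrinking with \<open>k\<close>, and off
  finitely many lines on which a denominator vanishes. This region is \<open>theta_dom q W k\<close>: all the
  arguments of \<open>g\<close> lie in \<open>W\<close> and all the denominators are nonzero.
\<close>

definition theta_dom :: "complex \<Rightarrow> (complex \<times> complex) set \<Rightarrow> nat \<Rightarrow> (complex \<times> complex) set" where
  "theta_dom q W k =
    {(x, y). (\<forall>i j. i + j \<le> k \<longrightarrow> (x / q ^ i, q ^ j * y) \<in> W) \<and>
             (\<forall>i j. i + j < k \<longrightarrow> x / q ^ Suc i \<noteq> q ^ j * y)}"

text \<open>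
  Hence the \<open>k\<close>-th power, as an analytic function on a fixed neighbourhood \<open>V\<close> of the origin, is the
  analytic function \<open>h\<close> on \<open>V\<close> that agrees with the iterated quotient wherever the latter can be
  evaluated. For \<open>V\<close> connected and \<open>V\<close>, \<open>W\<close> open neighbourhoods of the origin, \<open>h\<close> is unique on
  \<open>V\<close> by the identity theorem.
\<close>

definition is_theta_power ::
  "complex \<Rightarrow> (complex \<times> complex) set \<Rightarrow> (complex \<times> complex) set \<Rightarrow> nat
    \<Rightarrow> (complex \<times> complex \<Rightarrow> complex) \<Rightarrow> (complex \<times> complex \<Rightarrow> complex) \<Rightarrow> bool" where
  "is_theta_power q W V k g h \<longleftrightarrow>
    analytic2_on h V \<and> (\<forall>p \<in> V \<inter> theta_dom q W k. h p = (theta q ^^ k) g p)"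

text \<open>
  \<open>has_Ltilde q W V a b g p s\<close>: on \<open>V\<close>, all powers of \<open>theta\<close> applied to \<open>g\<close> (with domain \<open>W\<close>)
  exist in the above sense, and the series for \<open>L(a, b; \<theta>){g}\<close> at \<open>p\<close> converges with sum \<open>s\<close>.
\<close>

definition has_Ltilde ::
  "complex \<Rightarrow> (complex \<times> complex) set \<Rightarrow> (complex \<times> complex) set \<Rightarrow> complex \<Rightarrow> complex
    \<Rightarrow> (complex \<times> complex \<Rightarrow> complex) \<Rightarrow> complex \<times> complex \<Rightarrow> complex \<Rightarrow> bool" where
  "has_Ltilde q W V a b g p s \<longleftrightarrow>
    (\<exists>T. (\<forall>k. is_theta_power q W V k g (T k)) \<and>
      (\<lambda>k. q ^ (k * (k - 1) div 2) * qpoch a q k / qpoch q q k * (b ^ k * T k p)) sums s)"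

end

theory Submission
  imports Defs "HOL-Complex_Analysis.Complex_Analysis"
begin

text \<open>
  Expand \<open>f\<close> in powers of its last variable only, with coefficient functions \<open>A\<^sub>n\<close> of the
  remaining ones. Replacing the last variable by its product with \<open>q\<close> or \<open>q\<^sup>2\<close> multiplies
  the \<open>n\<close>-th coefficient by \<open>q\<^sup>n\<close> or \<open>q\<^sup>2\<^sup>n\<close>, so that comparing coefficients turns either
  functional equation into
  \<open>\<alpha> (1 - q\<^sup>n\<^sup>+\<^sup>1) A\<^sub>n\<^sub>+\<^sub>1 = q\<^sup>n (1 - a q\<^sup>n) (A'\<^sub>n - A''\<^sub>n)\<close>
  (\<open>maclaurin_recursion\<close>). Here \<open>\<alpha>\<close> is the denominator of the difference operator in question,
  \<open>x\<close> or \<open>x/q - y\<close>, and \<open>A'\<^sub>n\<close>, \<open>A''\<^sub>n\<close> are the two shifts of \<open>A\<^sub>n\<close> whose difference is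
  its numerator, up to sign. Thus \<open>A\<^sub>n\<^sub>+\<^sub>1\<close> is a constant times the operator applied to \<open>A\<^sub>n\<close>.
  The constants multiply up to the coefficients \<open>qweight q a n\<close> of the operator series, and
  \<open>A\<^sub>0\<close> is the restriction of \<open>f\<close> to last variable zero. Hence the operator series is, term by
  term, the Maclaurin series of \<open>f\<close> in the last variable, which converges on a polydisc around
  the origin. For \<open>\<bar>a\<bar> < 1\<close> the constants do not vanish, and each power of the operator is
  \<open>A\<^sub>n\<close> divided by \<open>qweight q a n\<close>, up to sign (\<open>Dq_power_eq_coeff\<close>, \<open>theta_power_eq_coeff\<close>).

  Two points need care. The first is the behaviour of these quotients where the denominator
  vanishes: it is covered by the continuity of \<open>A\<^sub>n\<close> for \<open>D\<^sub>q\<close> and by its analyticity for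
  \<open>\<theta>\<^sub>x\<^sub>y\<close>. The second is that the iterated quotient for \<open>\<theta>\<^sub>x\<^sub>y\<close> may involve points
  \<open>(x/q\<^sup>i, q\<^sup>j y)\<close> far from the origin, even in another component of the domain. Both are
  settled by taking \<open>A\<^sub>n\<close> at every point of the domain where the last variable vanishes, as a
  Maclaurin coefficient in this variable alone. The coefficient is then analytic near each such
  point, by regrouping the multiple power series there, and since the recursion only compares germs
  at last variable zero, it holds wherever the points in it belong to the domain.
\<close>

section \<open>Maclaurin expansion in the last variable\<close>

text \<open>
  Fubini for the multiple power series: with \<open>p\<close> ranging over the exponents of all the other
  variables, summing over \<open>p\<close> first gives a power series in \<open>z\<close>. Summability over \<open>p\<close> for
  fixed \<open>l\<close> is read off at a single \<open>z \<noteq> 0\<close>.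
\<close>

lemma maclaurin_of_family:
  fixes u :: "'p \<Rightarrow> nat \<Rightarrow> complex"
  assumes "r > 0"
    and sum: "\<And>z. norm z < r \<Longrightarrow> ((\<lambda>(p, l). u p l * z ^ l) has_sum g z) UNIV"
  shows "g has_fps_expansion fps_expansion g 0"
    and "((\<lambda>p. u p l) has_sum fps_nth (fps_expansion g 0) l) UNIV"
    and "norm z < r \<Longrightarrow> (\<lambda>l. fps_nth (fps_expansion g 0) l * z ^ l) sums g z"
proof -
  have swapped: "((\<lambda>(l, p). u p l * z ^ l) has_sum g z) (UNIV \<times> UNIV)" if "norm z < r" for z
    by (subst has_sum_swap) (use sum[OF that] in simp)
  have summable: "(\<lambda>p. u p l) summable_on UNIV" for l
  proof -
    define w :: complex where "w = of_real (r / 2)"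
    have w: "norm w < r" "w \<noteq> 0"
      using \<open>r > 0\<close> by (auto simp: w_def)
    have "(\<lambda>(l, p). u p l * w ^ l) summable_on (UNIV \<times> UNIV)"
      using swapped[OF w(1)] by (auto simp: summable_on_def)
    from summable_on_SigmaD1[OF this, of l] have "(\<lambda>p. u p l * w ^ l) summable_on UNIV"
      by simp
    then have "(\<lambda>p. u p l * w ^ l * inverse (w ^ l)) summable_on UNIV"
      by (rule summable_on_cmult_left)
    then show ?thesis
      using w(2) by (simp add: mult.assoc)
  qed
  have sums: "(\<lambda>l. (\<Sum>\<^sub>\<infinity>p. u p l) * z ^ l) sums g z" if "norm z < r" for z
  proof (rule has_sum_imp_sums, rule has_sum_SigmaD[OF swapped[OF that]])
    fix l
    show "((\<lambda>p. case (l, p) of (l, p) \<Rightarrow> u p l * z ^ l) has_sum (\<Sum>\<^sub>\<infinity>p. u p l) * z ^ l) UNIV"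
      using has_sum_cmult_left[OF has_sum_infsum[OF summable[of l]]] by simp
  qed
  have exp: "g has_fps_expansion Abs_fps (\<lambda>l. \<Sum>\<^sub>\<infinity>p. u p l)"
  proof (rule has_fps_expansionI)
    have "\<forall>\<^sub>F z in nhds 0. z \<in> ball (0 :: complex) r"
      using \<open>r > 0\<close> by (intro eventually_nhds_in_open) auto
    then show "\<forall>\<^sub>F z in nhds 0. (\<lambda>n. fps_nth (Abs_fps (\<lambda>l. \<Sum>\<^sub>\<infinity>p. u p l)) n * z ^ n) sums g z"
      by eventually_elim (use sums in auto)
  qed
  note eq = fps_expansion_eqI[OF exp]
  show "g has_fps_expansion fps_expansion g 0"
    using exp eq by simp
  show "((\<lambda>p. u p l) has_sum fps_nth (fps_expansion g 0) l) UNIV"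
    using has_sum_infsum[OF summable[of l]] eq by simp
  show "norm z < r \<Longrightarrow> (\<lambda>l. fps_nth (fps_expansion g 0) l * z ^ l) sums g z"
    using sums eq by simp
qed

text \<open>
  Separating the last exponent from the others brings the local power series of \<open>f\<close> into the shape of
  the preceding lemma, uniformly for all nearby values of the other variables.
\<close>

lemma analytic3_maclaurin:
  assumes "analytic3_on f U" "(a0, x0, 0) \<in> U"
  obtains r c where "r > 0"
    and "\<And>a x. norm (a - a0) < r \<Longrightarrow> norm (x - x0) < r \<Longrightarrow>
      (\<lambda>y. f (a, x, y)) has_fps_expansion fps_expansion (\<lambda>y. f (a, x, y)) 0"
    and "\<And>a x n. norm (a - a0) < r \<Longrightarrow> norm (x - x0) < r \<Longrightarrow>
      ((\<lambda>(h, i). c h i n * (a - a0) ^ h * (x - x0) ^ i)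
        has_sum fps_nth (fps_expansion (\<lambda>y. f (a, x, y)) 0) n) (UNIV :: (nat \<times> nat) set)"
    and "\<And>a x y. norm (a - a0) < r \<Longrightarrow> norm (x - x0) < r \<Longrightarrow> norm y < r \<Longrightarrow>
      (\<lambda>n. fps_nth (fps_expansion (\<lambda>y. f (a, x, y)) 0) n * y ^ n) sums f (a, x, y)"
proof -
  from assms obtain r c where "r > 0" and c: "\<And>a x y.
      norm (a - a0) < r \<Longrightarrow> norm (x - x0) < r \<Longrightarrow> norm (y - 0) < r \<Longrightarrow>
      ((\<lambda>(h, i, j). c h i j * (a - a0) ^ h * (x - x0) ^ i * (y - 0) ^ j) has_sum f (a, x, y))
        (UNIV :: (nat \<times> nat \<times> nat) set)"
    unfolding analytic3_on_def by fast
  have regrouped: "((\<lambda>(p, j). (case p of (h, i) \<Rightarrow> c h i j * (a - a0) ^ h * (x - x0) ^ i) * y ^ j)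
      has_sum f (a, x, y)) UNIV"
    if "norm (a - a0) < r" "norm (x - x0) < r" "norm y < r" for a x y
  proof -
    have bij: "bij_betw (\<lambda>((h, i), j). (h, i, j)) (UNIV :: ((nat \<times> nat) \<times> nat) set) UNIV"
      by (rule bij_betwI[of _ _ _ "\<lambda>(h, i, j). ((h, i), j)"]) auto
    show ?thesis
      using iffD2[OF has_sum_reindex_bij_betw[OF bij] c[of a x y]] that
      by (simp add: case_prod_unfold)
  qed
  show thesis
    by (rule that[OF \<open>r > 0\<close>, of c]; (rule maclaurin_of_family[OF \<open>r > 0\<close> regrouped] |
        use maclaurin_of_family[OF \<open>r > 0\<close> regrouped] in auto))
qed


lemma analytic4_maclaurin:
  assumes "analytic4_on f U" "(a0, x0, y0, 0) \<in> U"
  obtains r c where "r > 0"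
    and "\<And>a x y. norm (a - a0) < r \<Longrightarrow> norm (x - x0) < r \<Longrightarrow> norm (y - y0) < r \<Longrightarrow>
      (\<lambda>z. f (a, x, y, z)) has_fps_expansion fps_expansion (\<lambda>z. f (a, x, y, z)) 0"
    and "\<And>a x y n. norm (a - a0) < r \<Longrightarrow> norm (x - x0) < r \<Longrightarrow> norm (y - y0) < r \<Longrightarrow>
      ((\<lambda>(h, i, j). c h i j n * (a - a0) ^ h * (x - x0) ^ i * (y - y0) ^ j)
        has_sum fps_nth (fps_expansion (\<lambda>z. f (a, x, y, z)) 0) n) (UNIV :: (nat \<times> nat \<times> nat) set)"
    and "\<And>a x y z. norm (a - a0) < r \<Longrightarrow> norm (x - x0) < r \<Longrightarrow> norm (y - y0) < r \<Longrightarrow> norm z < r \<Longrightarrow>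
      (\<lambda>n. fps_nth (fps_expansion (\<lambda>z. f (a, x, y, z)) 0) n * z ^ n) sums f (a, x, y, z)"
proof -
  from assms obtain r c where "r > 0" and c: "\<And>a x y z.
      norm (a - a0) < r \<Longrightarrow> norm (x - x0) < r \<Longrightarrow> norm (y - y0) < r \<Longrightarrow> norm (z - 0) < r \<Longrightarrow>
      ((\<lambda>(h, i, j, l). c h i j l * (a - a0) ^ h * (x - x0) ^ i * (y - y0) ^ j * (z - 0) ^ l)
        has_sum f (a, x, y, z)) (UNIV :: (nat \<times> nat \<times> nat \<times> nat) set)"
    unfolding analytic4_on_def by fast
  have regrouped: "((\<lambda>(p, l). (case p of (h, i, j) \<Rightarrow>
        c h i j l * (a - a0) ^ h * (x - x0) ^ i * (y - y0) ^ j) * z ^ l) has_sum f (a, x, y, z)) UNIV"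
    if "norm (a - a0) < r" "norm (x - x0) < r" "norm (y - y0) < r" "norm z < r" for a x y z
  proof -
    have bij: "bij_betw (\<lambda>((h, i, j), l). (h, i, j, l))
        (UNIV :: ((nat \<times> nat \<times> nat) \<times> nat) set) UNIV"
      by (rule bij_betwI[of _ _ _ "\<lambda>(h, i, j, l). ((h, i, j), l)"]) auto
    show ?thesis
      using iffD2[OF has_sum_reindex_bij_betw[OF bij] c[of a x y z]] that
      by (simp add: case_prod_unfold)
  qed
  show thesis
    by (rule that[OF \<open>r > 0\<close>, of c]; (rule maclaurin_of_family[OF \<open>r > 0\<close> regrouped] |
        use maclaurin_of_family[OF \<open>r > 0\<close> regrouped] in auto))
qed

text \<open>
  In the power series of \<open>f\<close> about \<open>(a, 0, 0)\<close> only the terms of degree zero in the first variable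
  survive when this variable equals \<open>a\<close>. Those of degree \<open>n\<close> in \<open>y\<close> then give a power series in \<open>x\<close>.
\<close>

lemma isCont_maclaurin_coeff:
  assumes "analytic3_on f U" "(a, 0, 0) \<in> U"
  shows "isCont (\<lambda>x. fps_nth (fps_expansion (\<lambda>y. f (a, x, y)) 0) n) 0"
proof -
  obtain r c where "r > 0" and c: "\<And>b x n. norm (b - a) < r \<Longrightarrow> norm (x - 0) < r \<Longrightarrow>
      ((\<lambda>(h, i). c h i n * (b - a) ^ h * (x - 0) ^ i)
        has_sum fps_nth (fps_expansion (\<lambda>y. f (b, x, y)) 0) n) (UNIV :: (nat \<times> nat) set)"
    by (rule analytic3_maclaurin[OF assms]) (rule that; assumption)
  have sums: "(\<lambda>i. c 0 i n * x ^ i) sums fps_nth (fps_expansion (\<lambda>y. f (a, x, y)) 0) n"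
    if "norm x < r" for x
  proof (rule has_sum_imp_sums)
    have "((\<lambda>(h, i). c h i n * (a - a) ^ h * (x - 0) ^ i)
        has_sum fps_nth (fps_expansion (\<lambda>y. f (a, x, y)) 0) n) (range (Pair 0))"
      by (rule iffD1[OF has_sum_cong_neutral c]) (use that \<open>r > 0\<close> in auto)
    then show "((\<lambda>i. c 0 i n * x ^ i)
        has_sum fps_nth (fps_expansion (\<lambda>y. f (a, x, y)) 0) n) UNIV"
      by (subst (asm) has_sum_reindex) (auto simp: inj_on_def o_def)
  qed
  have "(\<lambda>x. fps_nth (fps_expansion (\<lambda>y. f (a, x, y)) 0) n) has_fps_expansion
      Abs_fps (\<lambda>i. c 0 i n)"
  proof (rule has_fps_expansionI)
    have "\<forall>\<^sub>F x in nhds 0. x \<in> ball (0 :: complex) r"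
      using \<open>r > 0\<close> by (intro eventually_nhds_in_open) auto
    then show "\<forall>\<^sub>F x in nhds 0. (\<lambda>i. fps_nth (Abs_fps (\<lambda>i. c 0 i n)) i * x ^ i) sums
        fps_nth (fps_expansion (\<lambda>y. f (a, x, y)) 0) n"
      by eventually_elim (use sums in auto)
  qed
  then show ?thesis
    using has_fps_expansion_imp_continuous by blast
qed

text \<open>
  The power series of \<open>f\<close> about \<open>(a, x0, y0, 0)\<close> itself yields that of the coefficient about
  \<open>(x0, y0)\<close>, so no power series has to be re-expanded about a new centre. The factor \<open>1 / k\<close>
  is the normalization by \<open>qweight\<close> that turns coefficients into powers of \<open>\<theta>\<^sub>x\<^sub>y\<close>.
\<close>

lemma analytic2_on_maclaurin_coeff:
  assumes "analytic4_on f U" "\<And>x y. (x, y) \<in> V \<Longrightarrow> (a, x, y, 0) \<in> U"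
  shows "analytic2_on (\<lambda>(x, y). fps_nth (fps_expansion (\<lambda>z. f (a, x, y, z)) 0) n / k) V"
  unfolding analytic2_on_def
proof (intro ballI, goal_cases)
  case (1 p)
  obtain x0 y0 where p: "p = (x0, y0)"
    by fastforce
  with 1 have "(x0, y0) \<in> V"
    by simp
  obtain r c where "r > 0" and c: "\<And>b x y n. norm (b - a) < r \<Longrightarrow> norm (x - x0) < r \<Longrightarrow>
      norm (y - y0) < r \<Longrightarrow> ((\<lambda>(h, i, j). c h i j n * (b - a) ^ h * (x - x0) ^ i * (y - y0) ^ j)
        has_sum fps_nth (fps_expansion (\<lambda>z. f (b, x, y, z)) 0) n) (UNIV :: (nat \<times> nat \<times> nat) set)"
    by (rule analytic4_maclaurin[OF assms(1) assms(2)[OF \<open>(x0, y0) \<in> V\<close>]]) (rule that; assumption)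
  have "((\<lambda>(i, j). c 0 i j n / k * (x - x0) ^ i * (y - y0) ^ j)
      has_sum fps_nth (fps_expansion (\<lambda>z. f (a, x, y, z)) 0) n / k) UNIV"
    if "norm (x - x0) < r" "norm (y - y0) < r" for x y
  proof -
    have "((\<lambda>(h, i, j). c h i j n * (a - a) ^ h * (x - x0) ^ i * (y - y0) ^ j)
        has_sum fps_nth (fps_expansion (\<lambda>z. f (a, x, y, z)) 0) n) (range (Pair 0))"
      by (rule iffD1[OF has_sum_cong_neutral c]) (use that \<open>r > 0\<close> in auto)
    then have "((\<lambda>(i, j). c 0 i j n * (x - x0) ^ i * (y - y0) ^ j)
        has_sum fps_nth (fps_expansion (\<lambda>z. f (a, x, y, z)) 0) n) UNIV"
      by (subst (asm) has_sum_reindex) (auto simp: inj_on_def o_def case_prod_unfold)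
    from has_sum_cmult_left[OF this, of "inverse k"] show ?thesis
      by (simp add: case_prod_unfold divide_inverse mult_ac)
  qed
  then show ?case
    unfolding p prod.case
    using \<open>r > 0\<close> by (intro exI[of _ r] conjI exI[of _ "\<lambda>i j. c 0 i j n / k"]) auto
qed

section \<open>The recursion for the coefficients\<close>

lemma has_fps_expansion_dilate:
  fixes g :: "complex \<Rightarrow> complex"
  assumes "g has_fps_expansion G"
  shows "(\<lambda>z. g (c * z)) has_fps_expansion (G oo (fps_const c * fps_X))"
proof -
  have "(\<lambda>z. c * z) has_fps_expansion fps_const c * fps_X"
    by (intro fps_expansion_intros)
  from has_fps_expansion_compose[OF assms this] show ?thesis
    by (simp add: o_def)
qed

text \<open>
  Both functional equations have this shape for fixed values of the other variables, \<open>g\<close>, \<open>g1\<close>,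
  \<open>g2\<close> being \<open>f\<close> at the unshifted and the two shifted points. Requiring the equation only near
  \<open>z = 0\<close> allows these points to be far apart.
\<close>

lemma maclaurin_recursion:
  fixes g g1 g2 :: "complex \<Rightarrow> complex"
  assumes G: "g has_fps_expansion G" "g1 has_fps_expansion G1" "g2 has_fps_expansion G2"
    and eq: "\<forall>\<^sub>F z in nhds 0. \<alpha> * (g z - g (q * z)) =
      z * (g1 (q * z) - g2 (q * z)) - a * z * (g1 (q^2 * z) - g2 (q^2 * z))"
  shows "\<alpha> * (1 - q ^ Suc n) * fps_nth G (Suc n) =
    q ^ n * (1 - a * q ^ n) * (fps_nth G1 n - fps_nth G2 n)"
proof -
  define S :: "complex fps \<Rightarrow> complex \<Rightarrow> complex fps" where "S = (\<lambda>F c. F oo (fps_const c * fps_X))"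
  have nth_S: "fps_nth (S F c) m = c ^ m * fps_nth F m" for F c m
    by (simp add: S_def)
  have lhs: "(\<lambda>z. \<alpha> * (g z - g (q * z))) has_fps_expansion fps_const \<alpha> * (G - S G q)"
    unfolding S_def by (intro fps_expansion_intros has_fps_expansion_dilate G)
  have "(\<lambda>z. z * (g1 (q * z) - g2 (q * z)) - a * (z * (g1 (q^2 * z) - g2 (q^2 * z))))
      has_fps_expansion
      fps_X * (S G1 q - S G2 q) - fps_const a * (fps_X * (S G1 (q^2) - S G2 (q^2)))"
    unfolding S_def by (intro fps_expansion_intros has_fps_expansion_dilate G)
  with eq have "(\<lambda>z. \<alpha> * (g z - g (q * z))) has_fps_expansion
      fps_X * (S G1 q - S G2 q) - fps_const a * (fps_X * (S G1 (q^2) - S G2 (q^2)))"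
    by (subst has_fps_expansion_cong[OF _ refl]) (auto simp: mult.assoc)
  from fps_expansion_unique_complex[OF lhs this]
  have "fps_nth (fps_const \<alpha> * (G - S G q)) (Suc n) =
      fps_nth (fps_X * (S G1 q - S G2 q) - fps_const a * (fps_X * (S G1 (q^2) - S G2 (q^2)))) (Suc n)"
    by simp
  moreover have "(q^2) ^ n = q ^ n * q ^ n"
    by (simp add: power2_eq_square power_mult_distrib)
  ultimately show ?thesis
    by (simp add: nth_S algebra_simps)
qed

section \<open>Coefficients of the operator series\<close>

definition qweight :: "complex \<Rightarrow> complex \<Rightarrow> nat \<Rightarrow> complex" where
  "qweight q a n = q ^ (n * (n - 1) div 2) * qpoch a q n / qpoch q q n"

lemma norm_mult_power_less_1:
  fixes a q :: complex
  assumes "norm a < 1" "norm q < 1"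
  shows "norm (a * q ^ n) < 1"
proof -
  have "norm (a * q ^ n) \<le> norm a * 1"
    unfolding norm_mult norm_power using assms by (intro mult_left_mono power_le_one) auto
  then show ?thesis
    using assms by simp
qed

lemma norm_mult_less:
  fixes q x :: complex
  assumes "norm q < 1" "norm x < r"
  shows "norm (q * x) < r"
proof -
  have "norm (q * x) \<le> norm x"
    unfolding norm_mult using assms by (intro mult_left_le_one_le) auto
  then show ?thesis
    using assms by simp
qed

lemma qpoch_nonzero:
  assumes "norm a < 1" "norm q < 1"
  shows "qpoch a q n \<noteq> 0"
  using norm_mult_power_less_1[OF assms] unfolding qpoch_def
  by (metis (no_types, lifting) finite_lessThan less_irrefl norm_one prod_zero_iff right_minus_eq)

lemma qweight_nonzero:
  assumes "q \<noteq> 0" "norm q < 1" "norm a < 1"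
  shows "qweight q a n \<noteq> 0"
  using assms by (simp add: qweight_def qpoch_nonzero)

lemma qweight_0 [simp]: "qweight q a 0 = 1"
  by (simp add: qweight_def qpoch_def)

lemma qweight_Suc:
  assumes "norm q < 1"
  shows "(1 - q ^ Suc n) * qweight q a (Suc n) = q ^ n * (1 - a * q ^ n) * qweight q a n"
proof -
  have exponent: "Suc n * (Suc n - 1) div 2 = n * (n - 1) div 2 + n"
    by (cases n) auto
  have "1 - q ^ Suc n \<noteq> 0"
    using norm_mult_power_less_1[OF assms assms, of n] by auto
  moreover have "qpoch q q n \<noteq> 0"
    using assms by (simp add: qpoch_nonzero)
  ultimately show ?thesis
    unfolding qweight_def exponent by (simp add: qpoch_def power_add field_simps)
qed

text \<open>
  Division by \<open>qweight\<close> normalizes the recursion: the quotients \<open>A / qweight q a n\<close> pass from \<open>n\<close>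
  to \<open>n + 1\<close> by the difference operator itself, with no constant.
\<close>

lemma coeff_Suc_div_qweight:
  assumes "q \<noteq> 0" "norm q < 1" "norm a < 1" "\<alpha> \<noteq> 0"
    and "\<alpha> * (1 - q ^ Suc n) * A' = q ^ n * (1 - a * q ^ n) * d"
  shows "A' / qweight q a (Suc n) = d / qweight q a n / \<alpha>"
proof -
  have nz: "1 - q ^ Suc n \<noteq> 0" "qweight q a n \<noteq> 0" "qweight q a (Suc n) \<noteq> 0"
    using norm_mult_power_less_1[OF assms(2,2), of n] assms qweight_nonzero by auto
  have "(1 - q ^ Suc n) * (\<alpha> * A' * qweight q a n) = (\<alpha> * (1 - q ^ Suc n) * A') * qweight q a n"
    by (simp only: mult_ac)
  also have "\<dots> = d * (q ^ n * (1 - a * q ^ n) * qweight q a n)"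
    unfolding assms(5) by (simp only: mult_ac)
  also have "\<dots> = (1 - q ^ Suc n) * (d * qweight q a (Suc n))"
    unfolding qweight_Suc[OF assms(2), symmetric] by (simp only: mult_ac)
  finally have "\<alpha> * A' * qweight q a n = d * qweight q a (Suc n)"
    using nz by simp
  then show ?thesis
    using nz \<open>\<alpha> \<noteq> 0\<close> by (simp add: field_simps)
qed

section \<open>Powers of the operators as coefficients\<close>

text \<open>
  The sign appears because \<open>A n (q * x) - A n x\<close> is minus the numerator of \<open>D\<^sub>q\<close>. At \<open>x = 0\<close> the
  recursion says nothing about \<open>A (Suc n)\<close>; there its value is recovered as the limit of its values
  at \<open>x \<noteq> 0\<close>, which is how \<open>Dq\<close> is defined.
\<close>

lemma Dq_power_eq_coeff:
  assumes q: "q \<noteq> 0" "norm q < 1" and a: "norm a < 1"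
    and "r > 0"
    and A0: "\<And>x. norm x < r \<Longrightarrow> A 0 x = g x"
    and cont: "\<And>n. isCont (A n) 0"
    and rec: "\<And>n x. norm x < r \<Longrightarrow>
      x * (1 - q ^ Suc n) * A (Suc n) x = q ^ n * (1 - a * q ^ n) * (A n (q * x) - A n x)"
    and "norm x < r"
  shows "(Dq q ^^ n) g x = (-1) ^ n * A n x / qweight q a n"
  using \<open>norm x < r\<close>
proof (induction n arbitrary: x)
  case 0
  then show ?case
    by (simp add: A0)
next
  case (Suc n)
  have quotient: "((Dq q ^^ n) g t - (Dq q ^^ n) g (q * t)) / t =
      (-1) ^ Suc n * A (Suc n) t / qweight q a (Suc n)" if t: "t \<noteq> 0" "norm t < r" for t
  proof -
    have "norm (q * t) < r"
      by (rule norm_mult_less[OF q(2) t(2)])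
    then have "((Dq q ^^ n) g t - (Dq q ^^ n) g (q * t)) / t =
        (-1) ^ n * (A n t - A n (q * t)) / qweight q a n / t"
      using t by (simp add: Suc.IH diff_divide_distrib right_diff_distrib)
    also have "\<dots> = (-1) ^ Suc n * ((A n (q * t) - A n t) / qweight q a n / t)"
      using qweight_nonzero[OF q a] t by (simp add: field_simps)
    also have "(A n (q * t) - A n t) / qweight q a n / t = A (Suc n) t / qweight q a (Suc n)"
      by (rule coeff_Suc_div_qweight[OF q a t(1) rec[OF t(2)], symmetric])
    finally show ?thesis
      by simp
  qed
  show ?case
  proof (cases "x = 0")
    case False
    then have Dq_x: "Dq q h x = (h x - h (q * x)) / x" for h
      by (simp add: Dq_def)
    show ?thesis
      using quotient[OF False Suc.prems] by (simp add: Dq_x)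
  next
    case True
    have "((\<lambda>t. (-1) ^ Suc n * A (Suc n) t / qweight q a (Suc n)) \<longlongrightarrow>
        (-1) ^ Suc n * A (Suc n) 0 / qweight q a (Suc n)) (at 0)"
      using cont[of "Suc n"] qweight_nonzero[OF q a]
      by (intro tendsto_intros) (auto simp: isCont_def)
    moreover have "\<forall>\<^sub>F t in at 0. (-1) ^ Suc n * A (Suc n) t / qweight q a (Suc n) =
        ((Dq q ^^ n) g t - (Dq q ^^ n) g (q * t)) / t"
      using \<open>r > 0\<close> quotient by (auto simp: eventually_at intro!: exI[of _ r])
    ultimately have "((\<lambda>t. ((Dq q ^^ n) g t - (Dq q ^^ n) g (q * t)) / t) \<longlongrightarrow>
        (-1) ^ Suc n * A (Suc n) 0 / qweight q a (Suc n)) (at 0)"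
      by (rule Lim_transform_eventually)
    then have "Lim (at 0) (\<lambda>t. ((Dq q ^^ n) g t - (Dq q ^^ n) g (q * t)) / t) =
        (-1) ^ Suc n * A (Suc n) 0 / qweight q a (Suc n)"
      by (intro tendsto_Lim) auto
    moreover have Dq_0: "Dq q h 0 = Lim (at 0) (\<lambda>t. (h t - h (q * t)) / t)" for h
      by (simp add: Dq_def)
    ultimately show ?thesis
      using True by (simp add: Dq_0)
  qed
qed

lemma theta_dom_Suc:
  assumes "(x, y) \<in> theta_dom q W (Suc n)"
  shows "(x / q, y) \<in> theta_dom q W n" "(x, q * y) \<in> theta_dom q W n"
    and "x / q \<noteq> y" "(x, y) \<in> W" "(x / q, y) \<in> W" "(x, q * y) \<in> W"
proof -
  have W: "(x / q ^ i, q ^ j * y) \<in> W" if "i + j \<le> Suc n" for i j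
    using assms that by (auto simp: theta_dom_def)
  have ne: "x / q ^ Suc i \<noteq> q ^ j * y" if "i + j < Suc n" for i j
    using assms that by (auto simp: theta_dom_def)
  show "x / q \<noteq> y" "(x, y) \<in> W" "(x / q, y) \<in> W" "(x, q * y) \<in> W"
    using W[of 0 0] W[of 1 0] W[of 0 1] ne[of 0 0] by auto
  show "(x / q, y) \<in> theta_dom q W n"
    using W[of "Suc _"] ne[of "Suc _"] by (auto simp: theta_dom_def)
  show "(x, q * y) \<in> theta_dom q W n"
    using W[of _ "Suc _"] ne[of _ "Suc _"] by (auto simp: theta_dom_def mult_ac)
qed

text \<open>
  Membership in \<open>theta_dom q W n\<close> supplies, at every stage of the iteration, exactly the three
  points and the nonzero denominator that the recursion asks for; hence \<open>W\<close> may be any set.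
\<close>

lemma theta_power_eq_coeff:
  assumes q: "q \<noteq> 0" "norm q < 1" and a: "norm a < 1"
    and B0: "\<And>p. p \<in> W \<Longrightarrow> B 0 p = g p"
    and rec: "\<And>n x y. (x, y) \<in> W \<Longrightarrow> (x / q, y) \<in> W \<Longrightarrow> (x, q * y) \<in> W \<Longrightarrow>
      (x / q - y) * (1 - q ^ Suc n) * B (Suc n) (x, y) =
        q ^ n * (1 - a * q ^ n) * (B n (x / q, y) - B n (x, q * y))"
    and "p \<in> theta_dom q W n"
  shows "(theta q ^^ n) g p = B n p / qweight q a n"
  using \<open>p \<in> theta_dom q W n\<close>
proof (induction n arbitrary: p)
  case 0
  moreover obtain x y where "p = (x, y)"
    by fastforce
  ultimately show ?case
    using B0[of p] by (auto simp: theta_dom_def)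
next
  case (Suc n)
  obtain x y where p: "p = (x, y)"
    by fastforce
  note dom = theta_dom_Suc[OF Suc.prems[unfolded p]]
  have theta_xy: "theta q h (x, y) = (h (x / q, y) - h (x, q * y)) / (x / q - y)" for h
    by (simp add: theta_def)
  have "(theta q ^^ Suc n) g p = (B n (x / q, y) - B n (x, q * y)) / qweight q a n / (x / q - y)"
    using Suc.IH dom(1,2) by (simp add: p theta_xy diff_divide_distrib)
  also have "\<dots> = B (Suc n) p / qweight q a (Suc n)"
    unfolding p using dom
    by (intro coeff_Suc_div_qweight[symmetric] q a rec) auto
  finally show ?case .
qed

section \<open>The two operator expansions\<close>

lemma eventually_mem_of_continuous:
  assumes "open U" "h 0 \<in> U" "continuous_on UNIV h"
  shows "\<forall>\<^sub>F z in nhds 0. h z \<in> U"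
proof -
  have "open (h -` U)"
    using assms by (intro open_vimage) auto
  then have "\<forall>\<^sub>F z in nhds 0. z \<in> h -` U"
    using assms by (intro eventually_nhds_in_open) auto
  then show ?thesis
    by simp
qed

lemma open_contains_ball_times:
  fixes U :: "('a::real_normed_vector \<times> 'b::topological_space) set"
  assumes "open U" "(0, b) \<in> U"
  obtains r V where "r > 0" "open V" "b \<in> V" "ball 0 r \<times> V \<subseteq> U"
proof -
  from open_prod_elim[OF assms] obtain A V where AV: "open A" "open V" "(0, b) \<in> A \<times> V" "A \<times> V \<subseteq> U"
    by blast
  then obtain r where "r > 0" "ball 0 r \<subseteq> A"
    using open_contains_ball[of A] by auto
  then show thesis
    using AV by (intro that[of r V]) auto
qed

lemma q_difference_eq_imp_Etilde:
  fixes f :: "complex \<times> complex \<times> complex \<Rightarrow> complex"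
  assumes q: "q \<noteq> 0" "norm q < 1"
    and U: "open U" "(0, 0, 0) \<in> U" and f: "analytic3_on f U"
    and eq: "\<And>a x y. {(a, x, y), (a, x, q * y), (a, q * x, q * y), (a, q * x, q^2 * y), (a, x, q^2 * y)} \<subseteq> U \<Longrightarrow>
           x * (f (a, x, y) - f (a, x, q * y)) =
           y * (f (a, q * x, q * y) - f (a, x, q * y))
           - a * y * (f (a, q * x, q^2 * y) - f (a, x, q^2 * y))"
  shows "\<exists>r>0. ball 0 r \<times> ball 0 r \<times> ball 0 r \<subseteq> U \<and>
           (\<forall>a\<in>ball 0 r. \<forall>x\<in>ball 0 r. \<forall>y\<in>ball 0 r.
              has_Etilde q a y (\<lambda>x. f (a, x, 0)) x (f (a, x, y)))"
proof -
  obtain r0 where "r0 > 0" and sums0: "\<And>a x y. norm (a - 0) < r0 \<Longrightarrow> norm (x - 0) < r0 \<Longrightarrow> norm y < r0 \<Longrightarrow>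
      (\<lambda>n. fps_nth (fps_expansion (\<lambda>y. f (a, x, y)) 0) n * y ^ n) sums f (a, x, y)"
    by (rule analytic3_maclaurin[OF f U(2)]) (rule that; assumption)
  obtain r1 V1 where r1: "r1 > 0" "open V1" "(0, 0) \<in> V1" "ball 0 r1 \<times> V1 \<subseteq> U"
    by (rule open_contains_ball_times[OF U])
  obtain r2 V2 where r2: "r2 > 0" "open V2" "0 \<in> V2" "ball 0 r2 \<times> V2 \<subseteq> V1"
    by (rule open_contains_ball_times[OF r1(2,3)])
  obtain r3 where r3: "r3 > 0" "ball 0 r3 \<subseteq> V2"
    using r2 open_contains_ball by blast
  (* The bound 1 makes norm a < 1, so that no qweight q a n vanishes. *)
  define r where "r = Min {1, r0, r1, r2, r3}"
  have r: "r > 0" "r \<le> 1" "r \<le> r0" "r \<le> r1" "r \<le> r2" "r \<le> r3"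
    using \<open>r0 > 0\<close> r1(1) r2(1) r3(1) by (auto simp: r_def)
  have sub: "ball 0 r \<times> ball 0 r \<times> ball 0 r \<subseteq> U"
  proof -
    have "ball 0 r \<times> ball 0 r \<times> ball 0 r \<subseteq> ball 0 r1 \<times> ball 0 r2 \<times> ball 0 r3"
      using r by (intro Sigma_mono subset_ball)
    also have "\<dots> \<subseteq> U"
      using r1(4) r2(4) r3(2) by blast
    finally show ?thesis .
  qed
  have "has_Etilde q a y (\<lambda>x. f (a, x, 0)) x (f (a, x, y))"
    if "norm a < r" "norm x < r" "norm y < r" for a x y
  proof -
    define A where "A = (\<lambda>n x. fps_nth (fps_expansion (\<lambda>y. f (a, x, y)) 0) n)"
    have inU: "(a, x, 0) \<in> U" if "norm x < r" for x
      using sub \<open>norm a < r\<close> that \<open>r > 0\<close> by auto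
    have exp: "(\<lambda>y. f (a, x, y)) has_fps_expansion fps_expansion (\<lambda>y. f (a, x, y)) 0"
      if "norm x < r" for x
      by (rule analytic3_maclaurin[OF f inU[OF that]]) auto
    have D: "(Dq q ^^ n) (\<lambda>x. f (a, x, 0)) x = (-1) ^ n * A n x / qweight q a n" for n
    proof (rule Dq_power_eq_coeff[OF q _ \<open>r > 0\<close>])
      show "norm a < 1"
        using \<open>norm a < r\<close> r by simp
      show "A 0 x = f (a, x, 0)" if "norm x < r" for x
        using has_fps_expansion_imp_0_eq_fps_nth_0[OF exp[OF that]] by (simp add: A_def)
      show "isCont (A n) 0" for n
        unfolding A_def using \<open>r > 0\<close> by (intro isCont_maclaurin_coeff[OF f inU]) auto
      show "x * (1 - q ^ Suc n) * A (Suc n) x = q ^ n * (1 - a * q ^ n) * (A n (q * x) - A n x)"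
        if x: "norm x < r" for n x
      proof -
        have qx: "norm (q * x) < r"
          by (rule norm_mult_less[OF q(2) x])
        have near: "\<forall>\<^sub>F y in nhds 0. (a, x', s * y) \<in> U" if "norm x' < r" for x' s
          using inU[OF that] by (intro eventually_mem_of_continuous U(1) continuous_intros) simp
        have "\<forall>\<^sub>F y in nhds 0. x * (f (a, x, y) - f (a, x, q * y)) =
            y * (f (a, q * x, q * y) - f (a, x, q * y))
            - a * y * (f (a, q * x, q^2 * y) - f (a, x, q^2 * y))"
          using near[OF x, of 1] near[OF x, of q] near[OF qx, of q] near[OF qx, of "q^2"]
            near[OF x, of "q^2"]
          by eventually_elim (rule eq, simp)
        from maclaurin_recursion[OF exp[OF x] exp[OF qx] exp[OF x] this] show ?thesis
          by (simp add: A_def)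
      qed
    qed fact
    have nz: "qweight q a n \<noteq> 0" for n
      using qweight_nonzero[OF q] \<open>norm a < r\<close> r by simp
    have "(-1) ^ n * q ^ (n * (n - 1) div 2) * qpoch a q n / qpoch q q n *
        (y ^ n * (Dq q ^^ n) (\<lambda>x. f (a, x, 0)) x) = A n x * y ^ n" for n
    proof -
      have "(-1) ^ n * q ^ (n * (n - 1) div 2) * qpoch a q n / qpoch q q n *
          (y ^ n * (Dq q ^^ n) (\<lambda>x. f (a, x, 0)) x) =
          ((-1) ^ n * (-1) ^ n) * (qweight q a n / qweight q a n) * (A n x * y ^ n)"
        unfolding D by (simp add: qweight_def mult_ac)
      then show ?thesis
        using nz by (simp flip: power_mult_distrib)
    qed
    moreover have "(\<lambda>n. A n x * y ^ n) sums f (a, x, y)"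
      unfolding A_def using that r by (intro sums0) auto
    ultimately show ?thesis
      by (simp add: has_Etilde_def)
  qed
  then show ?thesis
    using sub \<open>r > 0\<close> by (intro exI[of _ r]) auto
qed

lemma q_difference_eq_imp_Ltilde:
  fixes f :: "complex \<times> complex \<times> complex \<times> complex \<Rightarrow> complex"
  assumes q: "q \<noteq> 0" "norm q < 1"
    and U: "open U" "(0, 0, 0, 0) \<in> U" and f: "analytic4_on f U"
    and eq: "\<And>a x y z. {(a, x, y, z), (a, x, y, q * z), (a, x / q, y, q * z), (a, x, q * y, q * z),
                    (a, x, q * y, q^2 * z), (a, x / q, y, q^2 * z)} \<subseteq> U \<Longrightarrow>
           (x / q - y) * (f (a, x, y, z) - f (a, x, y, q * z)) =
           z * (f (a, x / q, y, q * z) - f (a, x, q * y, q * z))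
           + a * z * (f (a, x, q * y, q^2 * z) - f (a, x / q, y, q^2 * z))"
  shows "\<exists>r>0. ball 0 r \<times> ball 0 r \<times> ball 0 r \<times> ball 0 r \<subseteq> U \<and>
           (\<forall>a\<in>ball 0 r. \<forall>x\<in>ball 0 r. \<forall>y\<in>ball 0 r. \<forall>z\<in>ball 0 r.
              has_Ltilde q {(x, y). (a, x, y, 0) \<in> U} (ball 0 r \<times> ball 0 r) a z
                (\<lambda>(x, y). f (a, x, y, 0)) (x, y) (f (a, x, y, z)))"
proof -
  obtain r0 where "r0 > 0" and sums0: "\<And>a x y z. norm (a - 0) < r0 \<Longrightarrow> norm (x - 0) < r0 \<Longrightarrow>
      norm (y - 0) < r0 \<Longrightarrow> norm z < r0 \<Longrightarrow>
      (\<lambda>n. fps_nth (fps_expansion (\<lambda>z. f (a, x, y, z)) 0) n * z ^ n) sums f (a, x, y, z)"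
    by (rule analytic4_maclaurin[OF f U(2)]) (rule that; assumption)
  obtain r1 V1 where r1: "r1 > 0" "open V1" "(0, 0, 0) \<in> V1" "ball 0 r1 \<times> V1 \<subseteq> U"
    by (rule open_contains_ball_times[OF U])
  obtain r2 V2 where r2: "r2 > 0" "open V2" "(0, 0) \<in> V2" "ball 0 r2 \<times> V2 \<subseteq> V1"
    by (rule open_contains_ball_times[OF r1(2,3)])
  obtain r3 V3 where r3: "r3 > 0" "open V3" "0 \<in> V3" "ball 0 r3 \<times> V3 \<subseteq> V2"
    by (rule open_contains_ball_times[OF r2(2,3)])
  obtain r4 where r4: "r4 > 0" "ball 0 r4 \<subseteq> V3"
    using r3 open_contains_ball by blast
  (* The bound 1 makes norm a < 1, so that no qweight q a n vanishes. *)
  define r where "r = Min {1, r0, r1, r2, r3, r4}"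
  have r: "r > 0" "r \<le> 1" "r \<le> r0" "r \<le> r1" "r \<le> r2" "r \<le> r3" "r \<le> r4"
    using \<open>r0 > 0\<close> r1(1) r2(1) r3(1) r4(1) by (auto simp: r_def)
  have sub: "ball 0 r \<times> ball 0 r \<times> ball 0 r \<times> ball 0 r \<subseteq> U"
  proof -
    have "ball 0 r \<times> ball 0 r \<times> ball 0 r \<times> ball 0 r \<subseteq>
        ball 0 r1 \<times> ball 0 r2 \<times> ball 0 r3 \<times> ball 0 r4"
      using r by (intro Sigma_mono subset_ball)
    also have "ball 0 r1 \<times> ball 0 r2 \<times> ball 0 r3 \<times> ball 0 r4 \<subseteq> U"
    proof (intro subset_trans[OF _ r1(4)] Sigma_mono subset_refl)
      show "ball 0 r2 \<times> ball 0 r3 \<times> ball 0 r4 \<subseteq> V1"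
        using r4(2) by (intro subset_trans[OF Sigma_mono[OF subset_refl
              subset_trans[OF Sigma_mono[OF subset_refl] r3(4)]] r2(4)])
    qed
    finally show ?thesis .
  qed
  have "has_Ltilde q {(x, y). (a, x, y, 0) \<in> U} (ball 0 r \<times> ball 0 r) a z
      (\<lambda>(x, y). f (a, x, y, 0)) (x, y) (f (a, x, y, z))"
    if "norm a < r" "norm x < r" "norm y < r" "norm z < r" for a x y z
  proof -
    define W where "W = {(x, y). (a, x, y, 0) \<in> U}"
    define B where "B = (\<lambda>n (x, y). fps_nth (fps_expansion (\<lambda>z. f (a, x, y, z)) 0) n)"
    have a: "norm a < 1"
      using \<open>norm a < r\<close> r by simp
    have nz: "qweight q a n \<noteq> 0" for n
      by (rule qweight_nonzero[OF q a])
    have exp: "(\<lambda>z. f (a, x, y, z)) has_fps_expansion fps_expansion (\<lambda>z. f (a, x, y, z)) 0"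
      if "(x, y) \<in> W" for x y
    proof -
      from that have "(a, x, y, 0) \<in> U"
        by (simp add: W_def)
      then obtain s where "s > 0" and "\<And>b x' y'. norm (b - a) < s \<Longrightarrow> norm (x' - x) < s \<Longrightarrow>
          norm (y' - y) < s \<Longrightarrow>
          (\<lambda>z. f (b, x', y', z)) has_fps_expansion fps_expansion (\<lambda>z. f (b, x', y', z)) 0"
        by (rule analytic4_maclaurin[OF f]) (rule that; assumption)
      then show ?thesis
        by simp
    qed
    have theta: "(theta q ^^ n) (\<lambda>(x, y). f (a, x, y, 0)) p = B n p / qweight q a n"
      if "p \<in> theta_dom q W n" for n p
    proof (rule theta_power_eq_coeff[OF q a])
      show "B 0 p = (case p of (x, y) \<Rightarrow> f (a, x, y, 0))" if "p \<in> W" for p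
        using that has_fps_expansion_imp_0_eq_fps_nth_0[OF exp] by (cases p) (auto simp: B_def)
      show "(x / q - y) * (1 - q ^ Suc n) * B (Suc n) (x, y) =
          q ^ n * (1 - a * q ^ n) * (B n (x / q, y) - B n (x, q * y))"
        if W: "(x, y) \<in> W" "(x / q, y) \<in> W" "(x, q * y) \<in> W" for n x y
      proof -
        have near: "\<forall>\<^sub>F z in nhds 0. (a, x', y', s * z) \<in> U" if "(x', y') \<in> W" for x' y' s
          using that by (intro eventually_mem_of_continuous U(1) continuous_intros) (simp add: W_def)
        (* The a-term is rewritten as a subtraction to match the shape in maclaurin_recursion. *)
        have "\<forall>\<^sub>F z in nhds 0. (x / q - y) * (f (a, x, y, z) - f (a, x, y, q * z)) =
            z * (f (a, x / q, y, q * z) - f (a, x, q * y, q * z))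
            - a * z * (f (a, x / q, y, q^2 * z) - f (a, x, q * y, q^2 * z))"
          using near[OF W(1), of 1] near[OF W(1), of q] near[OF W(2), of q] near[OF W(3), of q]
            near[OF W(3), of "q^2"] near[OF W(2), of "q^2"]
        proof eventually_elim
          case (elim z)
          then show ?case
            using eq[of a x y z] by (simp add: algebra_simps)
        qed
        from maclaurin_recursion[OF exp[OF W(1)] exp[OF W(2)] exp[OF W(3)] this] show ?thesis
          by (simp add: B_def)
      qed
    qed fact
    have "analytic2_on (\<lambda>p. B n p / qweight q a n) (ball 0 r \<times> ball 0 r)" for n
    proof -
      have "analytic2_on (\<lambda>(x, y). fps_nth (fps_expansion (\<lambda>z. f (a, x, y, z)) 0) n / qweight q a n)
          (ball 0 r \<times> ball 0 r)"
        by (rule analytic2_on_maclaurin_coeff[OF f]) (use sub \<open>norm a < r\<close> \<open>r > 0\<close> in auto)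
      then show ?thesis
        by (simp add: B_def case_prod_unfold)
    qed
    then have "is_theta_power q W (ball 0 r \<times> ball 0 r) n (\<lambda>(x, y). f (a, x, y, 0))
        (\<lambda>p. B n p / qweight q a n)" for n
      using theta by (auto simp: is_theta_power_def)
    moreover have "(\<lambda>n. q ^ (n * (n - 1) div 2) * qpoch a q n / qpoch q q n *
        (z ^ n * (B n (x, y) / qweight q a n))) sums f (a, x, y, z)"
    proof -
      have "(\<lambda>n. B n (x, y) * z ^ n) sums f (a, x, y, z)"
        unfolding B_def prod.case using that r by (intro sums0) auto
      also have "(\<lambda>n. B n (x, y) * z ^ n) =
          (\<lambda>n. qweight q a n * (z ^ n * (B n (x, y) / qweight q a n)))"
        using nz by (simp add: mult_ac)
      finally show ?thesis
        by (simp only: qweight_def)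
    qed
    ultimately show ?thesis
      unfolding has_Ltilde_def W_def
      by (intro exI[of _ "\<lambda>n p. B n p / qweight q a n"] conjI allI)
  qed
  then show ?thesis
    using sub \<open>r > 0\<close> by (intro exI[of _ r]) auto
qed

theorem theorem2p2:
  fixes q :: complex
  assumes "0 < norm q" and "norm q < 1"
  shows
    "(\<forall>(f :: complex \<times> complex \<times> complex \<Rightarrow> complex) U.
        open U \<longrightarrow> (0, 0, 0) \<in> U \<longrightarrow> analytic3_on f U \<longrightarrow>
        (\<forall>a x y. {(a, x, y), (a, x, q * y), (a, q * x, q * y), (a, q * x, q^2 * y), (a, x, q^2 * y)} \<subseteq> U \<longrightarrow>
           x * (f (a, x, y) - f (a, x, q * y)) =
           y * (f (a, q * x, q * y) - f (a, x, q * y))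
           - a * y * (f (a, q * x, q^2 * y) - f (a, x, q^2 * y))) \<longrightarrow>
        (\<exists>r>0. ball 0 r \<times> ball 0 r \<times> ball 0 r \<subseteq> U \<and>
           (\<forall>a\<in>ball 0 r. \<forall>x\<in>ball 0 r. \<forall>y\<in>ball 0 r.
              has_Etilde q a y (\<lambda>x. f (a, x, 0)) x (f (a, x, y)))))
     \<and>
     (\<forall>(f :: complex \<times> complex \<times> complex \<times> complex \<Rightarrow> complex) U.
        open U \<longrightarrow> (0, 0, 0, 0) \<in> U \<longrightarrow> analytic4_on f U \<longrightarrow>
        (\<forall>a x y z. {(a, x, y, z), (a, x, y, q * z), (a, x / q, y, q * z), (a, x, q * y, q * z),
                    (a, x, q * y, q^2 * z), (a, x / q, y, q^2 * z)} \<subseteq> U \<longrightarrow>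
           (x / q - y) * (f (a, x, y, z) - f (a, x, y, q * z)) =
           z * (f (a, x / q, y, q * z) - f (a, x, q * y, q * z))
           + a * z * (f (a, x, q * y, q^2 * z) - f (a, x / q, y, q^2 * z))) \<longrightarrow>
        (\<exists>r>0. ball 0 r \<times> ball 0 r \<times> ball 0 r \<times> ball 0 r \<subseteq> U \<and>
           (\<forall>a\<in>ball 0 r. \<forall>x\<in>ball 0 r. \<forall>y\<in>ball 0 r. \<forall>z\<in>ball 0 r.
              has_Ltilde q {(x, y). (a, x, y, 0) \<in> U} (ball 0 r \<times> ball 0 r) a z
                (\<lambda>(x, y). f (a, x, y, 0)) (x, y) (f (a, x, y, z)))))"
proof -
  have q: "q \<noteq> 0" "norm q < 1"
    using assms by auto
  show ?thesis
    by (intro conjI allI impI; rule q_difference_eq_imp_Etilde[OF q] q_difference_eq_imp_Ltilde[OF q])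
      blast+
qed

end
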